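(* Let $r\in(-1,+\infty)$ and $\alpha\in(-1,r+1)$ be real numbers, and let $\binom{r}{\alpha}=\frac{\Gamma(1+r)}{\Gamma(1+\alpha)\Gamma(1+r-\alpha)}$. Then: (i) $\binom{r}{\alpha}>0$, $\binom{r}{0}=1$ and $\binom{r}{r}=1$; (ii) for $r=0$ (so $\alpha\in(-1,1)$): $\binom{0}{\alpha}=1$ if $\alpha=0$, and $\binom{0}{\alpha}=\frac{\sin\pi\alpha}{\pi\alpha}$ if $\alpha\neq 0$ and $\alpha\in(-1,1)$; (iii) $\binom{r}{r-\alpha}=\binom{r}{\alpha}$; (iv) $\binom{r}{\alpha}=\binom{r-1}{\alpha-1}+\binom{r-1}{\alpha}$ if $r\in(0,+\infty)$ and $\alpha\in(0,r)$; (v) for each fixed $r\in(-1,+\infty)$, the function $\phi(\alpha)=\binom{r}{\alpha}$ of $\alpha\in(-1,r+1)$ is strictly increasing on the interval $(-1,\frac{r}{2}]$ and strictly decreasing on the interval $[\frac{r}{2},r+1)$; (vi) for each fixed real $\alpha>-1$, the function $\psi(r)=\binom{r}{\alpha}$ of $r$, considered on the set of all real $r$ with $r>-1$ and $r>\alpha-1$ (i.e. $r\in(-1,+\infty)$ and $\alpha\in(-1,r+1)$), is strictly increasing if $\alpha>0$, strictly decreasing if $-1<\alpha<0$, and $\psi(r)\equiv 1$ if $\alpha=0$.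
   Context: $\Gamma$ denotes Euler's gamma function on $\mathbb{R}\setminus\{0,-1,-2,\ldots\}$. For real $r\in(-1,+\infty)$ and $\alpha\in(-1,r+1)$ the binomial coefficient of real arguments is defined by $\binom{r}{\alpha}=\frac{\Gamma(1+r)}{\Gamma(1+\alpha)\,\Gamma(1+r-\alpha)}$; under these conditions all three gamma values are taken at positive arguments. *)

theory Defs
  imports "HOL-Analysis.Gamma_Function"
begin

text \<open>
  The library's generalised binomial coefficient \<open>a gchoose k\<close> admits only natural \<open>k\<close>.
  This one is intended for \<open>r > -1\<close> and \<open>-1 < \<alpha> < r + 1\<close>, where all three arguments of
  the Gamma function are positive; outside that range its value is an artefact of the
  totality of \<open>Gamma\<close> and of division.
\<close>

definition real_binomial :: "real \<Rightarrow> real \<Rightarrow> real" where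
  "real_binomial r \<alpha> = Gamma (1 + r) / (Gamma (1 + \<alpha>) * Gamma (1 + r - \<alpha>))"

end

theory Submission
  imports Defs
begin

text \<open>
  The two monotonicity claims are both instances of one fact about \<open>\<Gamma>\<close> on the positive reals:
  for fixed \<open>d > 0\<close> the ratio \<open>\<Gamma>(x + d) / \<Gamma>(x)\<close> is strictly increasing in \<open>x\<close>. This is strict
  logarithmic convexity, and it holds because the logarithmic derivative of \<open>\<Gamma>\<close>, the digamma
  function, is strictly increasing.

  With \<open>r\<close> fixed, only the product \<open>\<Gamma>(1 + \<alpha>) \<Gamma>(1 + r - \<alpha>)\<close> in the denominator varies. Its two
  arguments have the constant sum \<open>r + 2\<close>, so by log-convexity the product becomes smaller as
  they approach each other, that is, as \<open>\<alpha>\<close> approaches \<open>r/2\<close> from the left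
  (\<open>real_binomial_less_left_half\<close>); the symmetry \<open>\<alpha> \<mapsto> r - \<alpha>\<close> settles the right half.

  With \<open>\<alpha>\<close> fixed, only \<open>\<Gamma>(1 + r) / \<Gamma>(1 + r - \<alpha>)\<close> varies. For \<open>\<alpha> > 0\<close> it is the ratio above with
  \<open>d = \<alpha>\<close>, for \<open>\<alpha> < 0\<close> it is the reciprocal of such a ratio with \<open>d = -\<alpha>\<close>. This is why the
  direction of monotonicity changes with the sign of \<open>\<alpha>\<close>.

  The remaining claims are algebra: Euler's reflection formula gives the row \<open>r = 0\<close>, and the
  recurrence \<open>\<Gamma>(x + 1) = x \<Gamma>(x)\<close> reduces Pascal's rule to \<open>\<alpha> + (r - \<alpha>) = r\<close>.
\<close>

text \<open>
  Strict log-convexity of \<open>\<Gamma>\<close> without division: the increment of \<open>ln \<Gamma>\<close> over a step of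
  fixed length \<open>d\<close> grows with the base point, since its derivative is
  \<open>Digamma (t + d) - Digamma t > 0\<close>.
\<close>

lemma Gamma_mult_shift_less:
  fixes x y d :: real
  assumes "0 < x" "x < y" "0 < d"
  shows "Gamma (x + d) * Gamma y < Gamma x * Gamma (y + d)"
proof -
  have "ln_Gamma (x + d) - ln_Gamma x < ln_Gamma (y + d) - ln_Gamma y"
  proof (rule DERIV_pos_imp_increasing[OF \<open>x < y\<close>])
    fix t :: real
    assume "x \<le> t" "t \<le> y"
    with assms have "0 < t" by simp
    have "((\<lambda>t. ln_Gamma (t + d) - ln_Gamma t) has_real_derivative (Digamma (t + d) - Digamma t)) (at t)"
      using \<open>0 < t\<close> \<open>0 < d\<close> by (auto intro!: derivative_eq_intros)
    moreover have "Digamma (t + d) - Digamma t > 0"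
      using Digamma_real_strict_mono[of t "t + d"] \<open>0 < t\<close> \<open>0 < d\<close> by simp
    ultimately show "\<exists>D. ((\<lambda>t. ln_Gamma (t + d) - ln_Gamma t) has_real_derivative D) (at t) \<and> 0 < D"
      by blast
  qed
  then have "exp (ln_Gamma (x + d) + ln_Gamma y) < exp (ln_Gamma x + ln_Gamma (y + d))"
    by simp
  with assms show ?thesis
    by (simp add: exp_add Gamma_real_pos_exp)
qed

lemma real_binomial_pos:
  assumes "r > -1" "-1 < \<alpha>" "\<alpha> < r + 1"
  shows "real_binomial r \<alpha> > 0"
  unfolding real_binomial_def using assms by (intro divide_pos_pos mult_pos_pos Gamma_real_pos) auto

lemma real_binomial_0_right:
  assumes "r > -1"
  shows "real_binomial r 0 = 1"
proof -
  have "Gamma (1 + r) > 0"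
    using assms by (intro Gamma_real_pos) simp
  then show ?thesis
    by (simp add: real_binomial_def)
qed

lemma real_binomial_symmetric: "real_binomial r (r - \<alpha>) = real_binomial r \<alpha>"
  by (simp add: real_binomial_def algebra_simps)

lemma real_binomial_self:
  assumes "r > -1"
  shows "real_binomial r r = 1"
  using real_binomial_symmetric[of r 0] real_binomial_0_right[OF assms] by simp

text \<open>
  By definition the left-hand side is \<open>1 / (\<Gamma>(1 + \<alpha>) \<Gamma>(1 - \<alpha>))\<close>. Working with the entire function
  \<open>1/\<Gamma>\<close> makes the reflection formula valid for every \<open>\<alpha> \<noteq> 0\<close>, poles of \<open>\<Gamma>\<close> included.
\<close>

lemma real_binomial_0_left:
  assumes "\<alpha> \<noteq> 0"
  shows "real_binomial 0 \<alpha> = sin (pi * \<alpha>) / (pi * \<alpha>)"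
proof -
  have "complex_of_real (rGamma \<alpha> * rGamma (1 - \<alpha>)) = complex_of_real (sin (pi * \<alpha>) / pi)"
    using rGamma_reflection_complex[of "complex_of_real \<alpha>"]
    by (simp flip: rGamma_complex_of_real sin_of_real)
  then have "rGamma \<alpha> * rGamma (1 - \<alpha>) = sin (pi * \<alpha>) / pi"
    by (simp only: of_real_eq_iff)
  moreover have "\<alpha> * rGamma (1 + \<alpha>) = rGamma \<alpha>"
    using rGamma_plus1[of \<alpha>] by (simp add: add.commute)
  ultimately have "\<alpha> * (rGamma (1 + \<alpha>) * rGamma (1 - \<alpha>)) = sin (pi * \<alpha>) / pi"
    by (metis mult.assoc)
  with assms have "rGamma (1 + \<alpha>) * rGamma (1 - \<alpha>) = sin (pi * \<alpha>) / (pi * \<alpha>)"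
    by (simp add: field_simps)
  then show ?thesis
    by (simp add: real_binomial_def rGamma_inverse_Gamma field_simps)
qed

text \<open>
  Over the common denominator \<open>\<Gamma>(1 + \<alpha>) \<Gamma>(1 + r - \<alpha>)\<close> the two summands have numerators
  \<open>\<alpha> \<Gamma>(r)\<close> and \<open>(r - \<alpha>) \<Gamma>(r)\<close>, which add up to \<open>\<Gamma>(1 + r)\<close>.
\<close>

lemma real_binomial_pascal:
  assumes "0 < \<alpha>" "\<alpha> < r"
  shows "real_binomial r \<alpha> = real_binomial (r - 1) (\<alpha> - 1) + real_binomial (r - 1) \<alpha>"
proof -
  have rec: "Gamma (1 + x) = x * Gamma x" if "x > 0" for x :: real
    using Gamma_plus1[of x] that by (force simp: add.commute elim!: nonpos_Ints_cases)
  have split: "(u + v) * c / (u * a * (v * b)) = c / (a * (v * b)) + c / (u * a * b)"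
    if "u > 0" "v > 0" "a > 0" "b > 0" for u v a b c :: real
    using that by (simp add: field_simps)
  have pos: "Gamma \<alpha> > 0" "Gamma (r - \<alpha>) > 0"
    using assms by auto
  have "Gamma (1 + r) = r * Gamma r" "Gamma (1 + \<alpha>) = \<alpha> * Gamma \<alpha>"
    "Gamma (1 + r - \<alpha>) = (r - \<alpha>) * Gamma (r - \<alpha>)"
    using rec[of r] rec[of \<alpha>] rec[of "r - \<alpha>"] assms by (simp_all add: add_diff_eq)
  then have "real_binomial r \<alpha> = r * Gamma r / (\<alpha> * Gamma \<alpha> * ((r - \<alpha>) * Gamma (r - \<alpha>)))"
    "real_binomial (r - 1) (\<alpha> - 1) = Gamma r / (Gamma \<alpha> * ((r - \<alpha>) * Gamma (r - \<alpha>)))"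
    "real_binomial (r - 1) \<alpha> = Gamma r / (\<alpha> * Gamma \<alpha> * Gamma (r - \<alpha>))"
    by (simp_all add: real_binomial_def diff_diff_eq2 add.commute[of r 1])
  moreover have "r * Gamma r / (\<alpha> * Gamma \<alpha> * ((r - \<alpha>) * Gamma (r - \<alpha>))) =
      Gamma r / (Gamma \<alpha> * ((r - \<alpha>) * Gamma (r - \<alpha>))) + Gamma r / (\<alpha> * Gamma \<alpha> * Gamma (r - \<alpha>))"
    using split[of \<alpha> "r - \<alpha>" "Gamma \<alpha>" "Gamma (r - \<alpha>)" "Gamma r"] assms pos by simp
  ultimately show ?thesis
    by simp
qed

text \<open>
  Moving from \<open>\<alpha>\<close> to \<open>\<beta>\<close> shifts the smaller argument \<open>1 + \<alpha>\<close> up and the larger argument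
  \<open>1 + r - \<alpha>\<close> down by the same \<open>d = \<beta> - \<alpha>\<close>. The bound \<open>\<alpha> + \<beta> < r\<close>, implied by \<open>\<alpha> < \<beta> \<le> r/2\<close>, is exactly
  what \<open>1 + \<alpha> < 1 + r - \<beta>\<close> demands of the two base points.
\<close>

lemma real_binomial_less_left_half:
  assumes "-1 < r" "-1 < \<alpha>" "\<alpha> < \<beta>" "\<alpha> + \<beta> < r"
  shows "real_binomial r \<alpha> < real_binomial r \<beta>"
proof -
  have "Gamma (1 + \<beta>) * Gamma (1 + r - \<beta>) < Gamma (1 + \<alpha>) * Gamma (1 + r - \<alpha>)"
    using Gamma_mult_shift_less[of "1 + \<alpha>" "1 + r - \<beta>" "\<beta> - \<alpha>"] assms
    by (simp add: algebra_simps)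
  moreover have "Gamma (1 + r) > 0" "Gamma (1 + \<beta>) * Gamma (1 + r - \<beta>) > 0"
    using assms by (auto intro!: mult_pos_pos Gamma_real_pos)
  ultimately show ?thesis
    unfolding real_binomial_def by (intro frac_less2) auto
qed

lemma real_binomial_strict_mono_left_half:
  assumes "-1 < r"
  shows "strict_mono_on {-1<..r / 2} (real_binomial r)"
  using assms by (intro strict_mono_onI real_binomial_less_left_half) auto

lemma real_binomial_strict_antimono_right_half:
  assumes "-1 < r"
  shows "strict_antimono_on {r / 2..<r + 1} (real_binomial r)"
proof (rule monotone_onI)
  fix \<alpha> \<beta>
  assume "\<alpha> \<in> {r / 2..<r + 1}" "\<beta> \<in> {r / 2..<r + 1}" "\<alpha> < \<beta>"
  with assms have "real_binomial r (r - \<beta>) < real_binomial r (r - \<alpha>)"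
    by (intro real_binomial_less_left_half) auto
  then show "real_binomial r \<alpha> > real_binomial r \<beta>"
    by (simp add: real_binomial_symmetric)
qed

lemma real_binomial_less_upper:
  assumes "0 < \<alpha>" "\<alpha> - 1 < r" "r < s"
  shows "real_binomial r \<alpha> < real_binomial s \<alpha>"
proof -
  have "Gamma (1 + r) * Gamma (1 + s - \<alpha>) < Gamma (1 + r - \<alpha>) * Gamma (1 + s)"
    using Gamma_mult_shift_less[of "1 + r - \<alpha>" "1 + s - \<alpha>" \<alpha>] assms by simp
  moreover have "Gamma (1 + \<alpha>) > 0" "Gamma (1 + r - \<alpha>) > 0" "Gamma (1 + s - \<alpha>) > 0"
    using assms by (auto intro!: Gamma_real_pos)
  ultimately show ?thesis
    by (simp add: real_binomial_def divide_simps mult_ac)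
qed

text \<open>
  For negative \<open>\<alpha>\<close> the smaller of the two arguments \<open>1 + r\<close> and \<open>1 + r - \<alpha>\<close> is the first, so the
  base points are \<open>1 + r < 1 + s\<close> and the step is \<open>-\<alpha>\<close>, which reverses the inequality.
\<close>

lemma real_binomial_greater_upper:
  assumes "-1 < \<alpha>" "\<alpha> < 0" "-1 < r" "r < s"
  shows "real_binomial s \<alpha> < real_binomial r \<alpha>"
proof -
  have "Gamma (1 + r - \<alpha>) * Gamma (1 + s) < Gamma (1 + r) * Gamma (1 + s - \<alpha>)"
    using Gamma_mult_shift_less[of "1 + r" "1 + s" "- \<alpha>"] assms by simp
  moreover have "Gamma (1 + \<alpha>) > 0" "Gamma (1 + r - \<alpha>) > 0" "Gamma (1 + s - \<alpha>) > 0"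
    using assms by (auto intro!: Gamma_real_pos)
  ultimately show ?thesis
    by (simp add: real_binomial_def divide_simps mult_ac)
qed

theorem theorem1:
  shows "(\<forall>r \<alpha> :: real. r > -1 \<and> \<alpha> \<in> {-1<..<r + 1} \<longrightarrow>
            real_binomial r \<alpha> > 0 \<and> real_binomial r 0 = 1 \<and> real_binomial r r = 1) \<and>
         (\<forall>\<alpha> :: real. \<alpha> \<in> {-1<..<1} \<longrightarrow>
            real_binomial 0 \<alpha> = (if \<alpha> = 0 then 1 else sin (pi * \<alpha>) / (pi * \<alpha>))) \<and>
         (\<forall>r \<alpha> :: real. r > -1 \<and> \<alpha> \<in> {-1<..<r + 1} \<longrightarrow>
            real_binomial r (r - \<alpha>) = real_binomial r \<alpha>) \<and>
         (\<forall>r \<alpha> :: real. r > 0 \<and> \<alpha> \<in> {0<..<r} \<longrightarrow>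
            real_binomial r \<alpha> = real_binomial (r - 1) (\<alpha> - 1) + real_binomial (r - 1) \<alpha>) \<and>
         (\<forall>r :: real. r > -1 \<longrightarrow>
            strict_mono_on {-1<..r / 2} (\<lambda>\<alpha>. real_binomial r \<alpha>) \<and>
            strict_antimono_on {r / 2..<r + 1} (\<lambda>\<alpha>. real_binomial r \<alpha>)) \<and>
         (\<forall>\<alpha> :: real. \<alpha> > -1 \<longrightarrow>
            (\<alpha> > 0 \<longrightarrow> strict_mono_on {r. r > -1 \<and> r > \<alpha> - 1} (\<lambda>r. real_binomial r \<alpha>)) \<and>
            (\<alpha> < 0 \<longrightarrow> strict_antimono_on {r. r > -1 \<and> r > \<alpha> - 1} (\<lambda>r. real_binomial r \<alpha>)) \<and>
            (\<alpha> = 0 \<longrightarrow> (\<forall>r \<in> {r. r > -1 \<and> r > \<alpha> - 1}. real_binomial r \<alpha> = 1)))"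
proof (intro conjI allI impI)
  fix r :: real
  assume "r > -1"
  then show "strict_mono_on {-1<..r / 2} (\<lambda>\<alpha>. real_binomial r \<alpha>)"
    by (rule real_binomial_strict_mono_left_half)
  from \<open>r > -1\<close> show "strict_antimono_on {r / 2..<r + 1} (\<lambda>\<alpha>. real_binomial r \<alpha>)"
    by (rule real_binomial_strict_antimono_right_half)
next
  fix \<alpha> :: real
  assume "\<alpha> > 0"
  then show "strict_mono_on {r. r > -1 \<and> r > \<alpha> - 1} (\<lambda>r. real_binomial r \<alpha>)"
    by (intro strict_mono_onI real_binomial_less_upper) auto
next
  fix \<alpha> :: real
  assume "\<alpha> > -1" "\<alpha> < 0"
  then show "strict_antimono_on {r. r > -1 \<and> r > \<alpha> - 1} (\<lambda>r. real_binomial r \<alpha>)"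
    by (intro monotone_onI real_binomial_greater_upper) auto
qed (auto simp: real_binomial_pos real_binomial_0_right real_binomial_self real_binomial_0_left
       real_binomial_symmetric intro: real_binomial_pascal)

end
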